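(* For $n\geq 3$, the Mycielskian of the cycle $C_n$ of length $n$ has general position number $$\mathrm{gp}(\mathcal{M}(C_n))=\begin{cases} n+1, & \text{if } n=3 \text{ or } n=5,\\ n, & \text{otherwise.}\end{cases}$$
   Context: A set $S$ of vertices of a graph $H$ is a general position set if no shortest path in $H$ contains three or more vertices of $S$; the general position number $\mathrm{gp}(H)$ is the number of vertices in a largest general position set of $H$. The Mycielskian $\mathcal{M}(G)$ of a graph $G$ with vertex set $V$ and edge set $E$ has vertex set $V\cup V'\cup\{u^*\}$, where $V'=\{u' : u\in V\}$ is a disjoint copy of $V$ and $u^*$ is an additional vertex (the root), and edge set $E\cup\{uv' : uv\in E\}\cup\{v'u^* : v'\in V'\}$ (for each edge $uv\in E$ both $uv'$ and $vu'$ are included). *)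

theory Defs
  imports "Graph_Theory.Pair_Digraph" "Graph_Theory.Vertex_Walk"
begin

text \<open>
  A finite simple graph is a \<^typ>\<open>'a pair_pre_digraph\<close> satisfying \<^locale>\<open>pair_graph\<close>: the arc
  relation is finite, irreflexive and symmetric, and an edge \<open>uv\<close> is the pair of arcs
  \<open>(u, v)\<close> and \<open>(v, u)\<close>.
\<close>

definition shortest_path :: "'a pair_pre_digraph \<Rightarrow> 'a vwalk \<Rightarrow> bool" where
  "shortest_path H p \<longleftrightarrow> vpath p H \<and>
     (\<forall>q. vpath q H \<and> hd q = hd p \<and> last q = last p \<longrightarrow> vwalk_length p \<le> vwalk_length q)"

definition general_position_set :: "'a pair_pre_digraph \<Rightarrow> 'a set \<Rightarrow> bool" where
  "general_position_set H S \<longleftrightarrow> S \<subseteq> pverts H \<and>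
     \<not> (\<exists>p. shortest_path H p \<and> card (set p \<inter> S) \<ge> 3)"

text \<open>Meaningful for finite \<open>H\<close> only, since \<^const>\<open>Max\<close> is unspecified on infinite sets.\<close>

definition gp_number :: "'a pair_pre_digraph \<Rightarrow> nat" where
  "gp_number H = Max (card ` {S. general_position_set H S})"

definition cycle_graph :: "nat \<Rightarrow> nat pair_pre_digraph" where
  "cycle_graph n = \<lparr> pverts = {0..<n},
     parcs = {(i, j). i < n \<and> j < n \<and> (j = (i + 1) mod n \<or> i = (j + 1) mod n)} \<rparr>"

datatype 'a myc_vertex = Orig 'a | Copy 'a | Root

definition mycielskian :: "'a pair_pre_digraph \<Rightarrow> 'a myc_vertex pair_pre_digraph" where
  "mycielskian G = \<lparr> pverts = Orig ` pverts G \<union> Copy ` pverts G \<union> {Root},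
     parcs = {(Orig u, Orig v) | u v. (u, v) \<in> parcs G}
       \<union> {(Orig u, Copy v) | u v. (u, v) \<in> parcs G}
       \<union> {(Copy v, Orig u) | u v. (u, v) \<in> parcs G}
       \<union> {(Copy v, Root) | v. v \<in> pverts G}
       \<union> {(Root, Copy v) | v. v \<in> pverts G} \<rparr>"

lemma pair_graphI:
  assumes "finite (pverts G)" "parcs G \<subseteq> pverts G \<times> pverts G" "sym (parcs G)" "irrefl (parcs G)"
  shows "pair_graph G"
proof -
  have "finite (parcs G)"
    using assms(1,2) by (meson finite_SigmaI finite_subset)
  with assms show ?thesis
    by unfold_locales (auto simp: symmetric_def irrefl_def)
qed

lemma pair_graph_cycle_graph:
  assumes "n \<ge> 3"
  shows "pair_graph (cycle_graph n)"
proof (rule pair_graphI)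
  have "Suc i mod n \<noteq> i" if "i < n" for i
    using assms that by (cases "Suc i = n") auto
  then show "irrefl (parcs (cycle_graph n))"
    by (auto simp: cycle_graph_def irrefl_def) metis
qed (auto simp: cycle_graph_def intro: symI)

lemma pair_graph_mycielskian:
  assumes "pair_graph G"
  shows "pair_graph (mycielskian G)"
proof -
  interpret pair_graph G by fact
  have "sym (parcs G)"
    using pair_sym_arcs by (simp add: symmetric_def)
  then show ?thesis
    by (intro pair_graphI)
      (auto simp: mycielskian_def irrefl_def sym_def dest: in_arcsD1 in_arcsD2 no_loops')
qed

lemma gp_number_attained:
  assumes "finite (pverts H)"
  shows "\<exists>S. general_position_set H S \<and> card S = gp_number H"
    and "general_position_set H S \<Longrightarrow> card S \<le> gp_number H"
proof -
  let ?C = "{S. general_position_set H S}"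
  have "?C \<subseteq> Pow (pverts H)" by (auto simp: general_position_set_def)
  then have fin: "finite (card ` ?C)" using assms by (meson finite_Pow_iff finite_imageI finite_subset)
  have "{} \<in> ?C" by (simp add: general_position_set_def)
  then have "gp_number H \<in> card ` ?C"
    unfolding gp_number_def using fin by (intro Max_in) auto
  then show "\<exists>S. general_position_set H S \<and> card S = gp_number H" by auto
  show "card S \<le> gp_number H" if "general_position_set H S"
    unfolding gp_number_def using fin that by (intro Max_ge) auto
qed

end

theory Submission
  imports Defs
begin

text \<open>
  Only shortest paths of length 2 and 3 matter for the upper bound. If \<open>a\<close> and \<open>c\<close> are distinct
  and non-adjacent, every path \<open>a b c\<close> is shortest, and if they moreover have no common neighbour,
  so is every path \<open>a b b' c\<close>. These paths forbid certain triples in a general position set \<open>S\<close> of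
  a Mycielskian, and the rest is counting.

  Let \<open>A\<close> and \<open>B\<close> be the sets of cycle vertices whose original, respectively copy, lies in \<open>S\<close>.
  If the root is in \<open>S\<close>, there is at most one copy, because the root lies between any two of them;
  and for \<open>n \<ge> 4\<close> at least two originals are missing, because three consecutive ones are forbidden;
  in the triangle one original is missing whenever there is a copy.
  Suppose that the root is not in \<open>S\<close>. If no successor of a vertex of \<open>A\<close> belongs to \<open>B\<close>, the
  successors of \<open>A\<close> and the set \<open>B\<close> are disjoint sets of cycle vertices, so \<open>|A| + |B| \<le> n\<close>.
  Otherwise let \<open>i \<in> A\<close> and \<open>i + 1 \<in> B\<close>. Then \<open>i + 1\<close>, and for \<open>n \<ge> 4\<close> also \<open>i - 1\<close> and \<open>i + 2\<close>, are
  not in \<open>A\<close>, and \<open>i - 1\<close> is not in \<open>B\<close>. This suffices for \<open>n \<le> 5\<close>. The decisive fact for larger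
  \<open>n\<close> is that a copy at cycle distance at least 3 from \<open>i\<close> has distance exactly 3 from the
  original \<open>i\<close>, by a shortest path through the copy \<open>i + 1\<close> and the root. Hence \<open>B\<close> has at most
  four elements, while \<open>A\<close> omits four vertices when \<open>n \<ge> 7\<close>, the fourth because three consecutive
  originals are forbidden; \<open>n = 6\<close> is a short case distinction on \<open>i + 3\<close>.

  For the lower bound, the \<open>n\<close> copies are in general position, being pairwise non-adjacent with
  the root as common neighbour. The exceptional sets are the root with the triangle for
  \<open>n = 3\<close>, and for \<open>n = 5\<close> six vertices inducing two disjoint edges and two isolated vertices.
  Any two vertices of one of these sets are at distance at most 2, so a shortest path through
  three of them would contain an induced path of length 2 inside the set; this is
  \<open>general_position_set_if_diameter_le_2\<close>.
\<close>

section \<open>Shortest paths and general position\<close>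

lemma length_vwalk_to_vpath_le: "length (vwalk_to_vpath p) \<le> length p"
proof (induction p rule: vwalk_to_vpath_induct3)
  case (in_set x xs)
  then show ?case
    using length_dropWhile_le[of "\<lambda>y. y \<noteq> x" xs] by simp
qed simp_all

text \<open>
  A walk contracts to a path with the same ends, so a shortest path may be compared with walks.
  This spares the distinctness check when part of a path is replaced.
\<close>

lemma shortest_path_le_vwalk:
  assumes "shortest_path H p" "vwalk q H" "hd q = hd p" "last q = last p"
  shows "length p \<le> length q"
proof -
  have "length p - 1 \<le> length (vwalk_to_vpath q) - 1"
    using assms unfolding shortest_path_def
    by (auto simp: vwalk_to_vpath_vpath vwalk_to_vpath_hd vwalk_to_vpath_last)
  moreover have "vwalk_to_vpath q \<noteq> []"
    using assms(2) by (intro vwalk_to_vpath_nonempty) auto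
  ultimately show ?thesis
    using length_vwalk_to_vpath_le[of q] by (cases "vwalk_to_vpath q") auto
qed

lemma vwalk_append_iff:
  assumes "p \<noteq> []" "q \<noteq> []"
  shows "vwalk (p @ q) H \<longleftrightarrow> vwalk p H \<and> vwalk q H \<and> (last p, hd q) \<in> arcs_ends H"
  using assms by (auto simp: vwalk_def vwalk_arcs_append)

lemma shortest_path_two:
  assumes "pair_wf_digraph H"
    and "(a, b) \<in> parcs H" "(b, c) \<in> parcs H" "a \<noteq> c" "(a, c) \<notin> parcs H" "a \<noteq> b" "b \<noteq> c"
  shows "shortest_path H [a, b, c]"
proof -
  interpret pair_wf_digraph H by fact
  have "Suc (Suc 0) \<le> length q - Suc 0" if "vpath q H" "hd q = a" "last q = c" for q
    using that assms(4,5)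
    by (cases q rule: vwalk_arcs.cases) (auto simp: vpath_def vwalk_def Suc_le_eq)
  then show ?thesis
    using assms by (auto simp: shortest_path_def vpath_def intro: in_arcsD1 in_arcsD2)
qed

lemma shortest_path_three:
  assumes "pair_wf_digraph H"
    and "(a, b) \<in> parcs H" "(b, c) \<in> parcs H" "(c, d) \<in> parcs H" "distinct [a, b, c, d]"
    and "(a, d) \<notin> parcs H" "\<And>x. (a, x) \<in> parcs H \<Longrightarrow> (x, d) \<notin> parcs H"
  shows "shortest_path H [a, b, c, d]"
proof -
  interpret pair_wf_digraph H by fact
  have "Suc (Suc (Suc 0)) \<le> length q - Suc 0" if q: "vpath q H" "hd q = a" "last q = d" for q
  proof (rule ccontr)
    assume "\<not> Suc (Suc (Suc 0)) \<le> length q - Suc 0"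
    moreover have "q \<noteq> []" using q by (auto simp: vpath_def)
    then have "length q \<noteq> 0" by simp
    ultimately have "length q = 1 \<or> length q = 2 \<or> length q = 3" by linarith
    then show False
      using q assms(5-7) by (auto simp: numeral_eq_Suc length_Suc_conv vpath_def)
  qed
  then show ?thesis
    using assms by (auto simp: shortest_path_def vpath_def intro: in_arcsD1 in_arcsD2)
qed

lemma general_position_set_no_triple:
  assumes "general_position_set H S" "shortest_path H p"
    and "{x, y, z} \<subseteq> S" "{x, y, z} \<subseteq> set p" "distinct [x, y, z]"
  shows False
proof -
  have "card {x, y, z} \<le> card (set p \<inter> S)"
    using assms by (intro card_mono) auto
  moreover have "card {x, y, z} = 3" using assms(5) by simp
  ultimately show False using assms(1,2) unfolding general_position_set_def by auto
qed

text \<open>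
  Suppose that \<open>x\<close>, \<open>y\<close>, \<open>z\<close> from \<open>S\<close> occur in this order on a shortest path. The part from \<open>x\<close> to \<open>z\<close>
  can be replaced by any walk between them, so it has length at most 2 and must be the path
  \<open>x y z\<close> itself. The hypothesis \<open>clique\<close>, which says that \<open>S\<close> induces a disjoint union of
  cliques, then provides the shortcut from \<open>x\<close> to \<open>z\<close>.
\<close>

lemma general_position_set_if_diameter_le_2:
  assumes "pair_wf_digraph H" "S \<subseteq> pverts H"
    and near: "\<And>x z. x \<in> S \<Longrightarrow> z \<in> S \<Longrightarrow> x \<noteq> z
      \<Longrightarrow> (x, z) \<in> parcs H \<or> (\<exists>y. (x, y) \<in> parcs H \<and> (y, z) \<in> parcs H)"
    and clique: "\<And>x y z. {x, y, z} \<subseteq> S \<Longrightarrow> (x, y) \<in> parcs H \<Longrightarrow> (y, z) \<in> parcs H \<Longrightarrow> x \<noteq> z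
      \<Longrightarrow> (x, z) \<in> parcs H"
  shows "general_position_set H S"
proof -
  interpret pair_wf_digraph H by fact
  have False if p: "shortest_path H p" and three: "card (set p \<inter> S) \<ge> 3" for p
  proof -
    have dist: "distinct p" and wp: "vwalk p H" using p by (auto simp: shortest_path_def)
    have "length (filter (\<lambda>x. x \<in> S) p) \<ge> 3"
      using three distinct_card[of "filter (\<lambda>x. x \<in> S) p"] dist
      by (simp add: Int_def conj_commute)
    then obtain x y z ws where filter: "filter (\<lambda>x. x \<in> S) p = x # y # z # ws"
      by (auto simp: numeral_eq_Suc Suc_le_length_iff)
    obtain p1 r1 where 1: "p = p1 @ x # r1" "x \<in> S" "y # z # ws = filter (\<lambda>x. x \<in> S) r1"
      using filter_eq_ConsD[OF filter] by blast
    obtain p2 r2 where 2: "r1 = p2 @ y # r2" "y \<in> S" "z # ws = filter (\<lambda>x. x \<in> S) r2"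
      using filter_eq_ConsD[OF 1(3)[symmetric]] by blast
    obtain p3 p4 where 3: "r2 = p3 @ z # p4" "z \<in> S"
      using filter_eq_ConsD[OF 2(3)[symmetric]] by blast
    have p_eq: "p = p1 @ x # p2 @ y # p3 @ z # p4" and S: "{x, y, z} \<subseteq> S"
      using 1 2 3 by simp_all
    have xz: "x \<noteq> z" using dist p_eq by auto
    \<comment> \<open>Replacing the part between \<open>x\<close> and \<open>z\<close> by another walk cannot shorten \<open>p\<close>.\<close>
    have short: "length p \<le> length (p1 @ x # q @ z # p4)" if q: "vwalk (x # q @ [z]) H" for q
    proof (rule shortest_path_le_vwalk[OF p])
      have zp: "vwalk (z # p4) H"
        using vwalkI_append_r[of "z # p4" "p1 @ x # p2 @ y # p3"] wp p_eq by simp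
      have xp: "vwalk (p1 @ [x]) H"
        using vwalkI_append_l[of "p1 @ [x]" "p2 @ y # p3 @ z # p4"] wp p_eq by simp
      have "vwalk ((p1 @ [x]) @ (q @ [z])) H"
      proof (subst vwalk_append_iff)
        show "vwalk (p1 @ [x]) H \<and> vwalk (q @ [z]) H \<and>
          (last (p1 @ [x]), hd (q @ [z])) \<in> arcs_ends H"
          using xp q vwalk_append_iff[of "[x]" "q @ [z]" H] by simp
      qed auto
      then have "vwalk ((p1 @ x # q) @ [z]) H" by simp
      then show "vwalk (p1 @ x # q @ z # p4) H"
        using zp vwalk_append_iff[of "p1 @ x # q @ [z]" p4 H] vwalk_append_iff[of "[z]" p4 H]
        by (cases "p4 = []") auto
    qed (auto simp: p_eq hd_append)
    have not_adj: "(x, z) \<notin> parcs H"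
    proof
      assume "(x, z) \<in> parcs H"
      then have "length p \<le> length (p1 @ x # [] @ z # p4)"
        by (intro short) (auto intro: in_arcsD1 in_arcsD2)
      then show False using p_eq by simp
    qed
    then obtain m where "(x, m) \<in> parcs H" "(m, z) \<in> parcs H"
      using near xz S by blast
    then have "length p \<le> length (p1 @ x # [m] @ z # p4)"
      by (intro short) (auto intro: in_arcsD1 in_arcsD2)
    then have "p2 = []" "p3 = []" using p_eq by auto
    then have "(x, y) \<in> parcs H" "(y, z) \<in> parcs H"
      using vwalkI_append_r[of "x # y # z # p4" p1 "with_proj H"] wp p_eq by auto
    then show False using clique S xz not_adj by blast
  qed
  then show ?thesis using assms(2) by (auto simp: general_position_set_def)
qed

section \<open>Forbidden triples in Mycielskians\<close>

lemma pverts_mycielskian: "pverts (mycielskian G) = Orig ` pverts G \<union> Copy ` pverts G \<union> {Root}"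
  by (simp add: mycielskian_def)

lemma parcs_mycielskian [simp]:
  "(Orig u, Orig v) \<in> parcs (mycielskian G) \<longleftrightarrow> (u, v) \<in> parcs G"
  "(Orig u, Copy v) \<in> parcs (mycielskian G) \<longleftrightarrow> (u, v) \<in> parcs G"
  "(Copy u, Orig v) \<in> parcs (mycielskian G) \<longleftrightarrow> (v, u) \<in> parcs G"
  "(Copy u, Copy v) \<notin> parcs (mycielskian G)"
  "(Copy u, Root) \<in> parcs (mycielskian G) \<longleftrightarrow> u \<in> pverts G"
  "(Root, Copy u) \<in> parcs (mycielskian G) \<longleftrightarrow> u \<in> pverts G"
  "(Orig u, Root) \<notin> parcs (mycielskian G)"
  "(Root, Orig u) \<notin> parcs (mycielskian G)"
  "(Root, Root) \<notin> parcs (mycielskian G)"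
  by (auto simp: mycielskian_def)

locale mycielskian_general_position = pair_graph G for G :: "'a pair_pre_digraph" +
  fixes S
  assumes general_position: "general_position_set (mycielskian G) S"
begin

lemma sym_arc: "(u, v) \<in> parcs G \<Longrightarrow> (v, u) \<in> parcs G"
  using pair_sym_arcs by (auto simp: symmetric_def dest: symD)

lemma arc_neq: "(u, v) \<in> parcs G \<Longrightarrow> u \<noteq> v"
  using no_loops' by blast

lemma wf_mycielskian: "pair_wf_digraph (mycielskian G)"
proof -
  interpret M: pair_graph "mycielskian G"
    by (rule pair_graph_mycielskian) unfold_locales
  show ?thesis by unfold_locales
qed

lemma subset_mycielskian: "S \<subseteq> pverts (mycielskian G)"
  using general_position by (simp add: general_position_set_def)

lemma no_induced_path:
  assumes "(a, b) \<in> parcs (mycielskian G)" "(b, c) \<in> parcs (mycielskian G)" "distinct [a, b, c]"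
    and "(a, c) \<notin> parcs (mycielskian G)" "a \<in> S" "b \<in> S" "c \<in> S"
  shows False
  using assms general_position_set_no_triple[OF general_position, of "[a, b, c]" a b c]
    shortest_path_two[OF wf_mycielskian, of a b c]
  by auto

text \<open>
  In each of the next five lemmas the excluded vertices form an induced path of length 2. The
  middle one is the second vertex named, except that the root lies between two copies. Non-adjacency
  of the ends is automatic for two copies, and also for a vertex and its own copy: the case
  \<open>u = w\<close> of \<open>no_copy_orig_orig\<close> is the path from a copy to its original through a neighbour.
\<close>

lemma no_Root_two_copies:
  assumes "Root \<in> S" "Copy u \<in> S" "Copy v \<in> S" shows "u = v"
proof (rule ccontr)
  assume "u \<noteq> v"
  then show False
    using assms no_induced_path[of "Copy u" Root "Copy v"] subset_mycielskian
    by (auto simp: pverts_mycielskian)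
qed

lemma no_copy_orig_copy:
  assumes "(u, v) \<in> parcs G" "(v, w) \<in> parcs G" "u \<noteq> w"
    and "Copy u \<in> S" "Orig v \<in> S" shows "Copy w \<notin> S"
  using assms no_induced_path[of "Copy u" "Orig v" "Copy w"] by (auto dest: sym_arc)

lemma no_orig_copy_orig:
  assumes "(u, v) \<in> parcs G" "(v, w) \<in> parcs G" "u \<noteq> w" "(u, w) \<notin> parcs G"
    and "Orig u \<in> S" "Copy v \<in> S" shows "Orig w \<notin> S"
  using assms no_induced_path[of "Orig u" "Copy v" "Orig w"] by (auto dest: sym_arc)

lemma no_orig_orig_orig:
  assumes "(u, v) \<in> parcs G" "(v, w) \<in> parcs G" "u \<noteq> w" "(u, w) \<notin> parcs G"
    and "Orig u \<in> S" "Orig v \<in> S" shows "Orig w \<notin> S"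
  using assms no_induced_path[of "Orig u" "Orig v" "Orig w"] by (auto dest: arc_neq)

lemma no_copy_orig_orig:
  assumes "(u, v) \<in> parcs G" "(v, w) \<in> parcs G" "(u, w) \<notin> parcs G"
    and "Copy u \<in> S" "Orig v \<in> S" shows "Orig w \<notin> S"
  using assms no_induced_path[of "Copy u" "Orig v" "Orig w"] by (auto dest: sym_arc arc_neq)

text \<open>
  An original and a copy are at distance at most 3, since copies are joined through the
  root. The hypotheses make the distance between \<open>Orig u\<close> and \<open>Copy w\<close> exactly 3, and then
  every \<open>Copy v\<close> adjacent to \<open>Orig u\<close> lies on a shortest path between the two.
\<close>

lemma no_orig_copy_far_copy:
  assumes "(u, v) \<in> parcs G" "u \<noteq> w" "(u, w) \<notin> parcs G"
    and "\<And>x. (u, x) \<in> parcs G \<Longrightarrow> (x, w) \<notin> parcs G"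
    and "Orig u \<in> S" "Copy v \<in> S" shows "Copy w \<notin> S"
proof
  assume w: "Copy w \<in> S"
  have "v \<in> pverts G" "w \<in> pverts G"
    using w assms subset_mycielskian by (auto simp: pverts_mycielskian)
  moreover have "v \<noteq> w" using assms by auto
  moreover have "(x, Copy w) \<notin> parcs (mycielskian G)"
    if "(Orig u, x) \<in> parcs (mycielskian G)" for x
    using that assms(4) by (cases x) auto
  ultimately have "shortest_path (mycielskian G) [Orig u, Copy v, Root, Copy w]"
    using assms by (intro shortest_path_three wf_mycielskian) auto
  then show False
    by (rule general_position_set_no_triple[OF general_position, where x = "Orig u"
          and y = "Copy v" and z = "Copy w"]) (use assms w \<open>v \<noteq> w\<close> in auto)
qed

end

section \<open>The cycle\<close>

lemma pverts_cycle_graph [simp]: "pverts (cycle_graph n) = {0..<n}"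
  by (simp add: cycle_graph_def)

lemma inj_on_shift_mod: "inj_on (\<lambda>k. (i + k) mod n) {0..<n :: nat}"
proof (rule inj_onI)
  fix j k assume jk: "j \<in> {0..<n}" "k \<in> {0..<n}" "(i + j) mod n = (i + k) mod n"
  have "int j mod int n = int k mod int n"
    using jk(3) by (metis mod_add_left_eq add_diff_cancel_left' mod_diff_left_eq of_nat_add of_nat_mod)
  then show "j = k" using jk by simp
qed

lemma shift_mod_image:
  assumes "n > 0"
  shows "(\<lambda>k. (i + k) mod n) ` {0..<n} = {0..<n :: nat}"
  using assms by (intro endo_inj_surj inj_on_shift_mod) auto

lemma shift_mod_eq_iff:
  "j < n \<Longrightarrow> k < n \<Longrightarrow> (i + j) mod n = (i + k) mod n \<longleftrightarrow> j = (k :: nat)"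
  using inj_on_eq_iff[OF inj_on_shift_mod, of j n k i] by simp

text \<open>
  Rotations are automorphisms of the cycle. Positions relative to a base point \<open>i\<close> therefore have
  a description of adjacency by linear inequalities, without modular arithmetic.
\<close>

lemma parcs_cycle_graph_shift:
  assumes "n \<ge> 3" "j < n" "k < n"
  shows "((i + j) mod n, (i + k) mod n) \<in> parcs (cycle_graph n) \<longleftrightarrow>
    k = j + 1 \<or> j = k + 1 \<or> j = 0 \<and> k = n - 1 \<or> k = 0 \<and> j = n - 1"
proof -
  \<comment> \<open>The vertex at position \<open>b\<close> is the successor of the one at position \<open>a\<close>.\<close>
  have succ: "(i + b) mod n = ((i + a) mod n + 1) mod n \<longleftrightarrow> b = a + 1 \<or> b = 0 \<and> a = n - 1"
    if ab: "a < n" "b < n" for a b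
  proof -
    have "((i + a) mod n + 1) mod n = (i + (a + 1) mod n) mod n"
      by (simp add: mod_simps)
    moreover have "(a + 1) mod n < n" using assms by simp
    ultimately have "(i + b) mod n = ((i + a) mod n + 1) mod n \<longleftrightarrow> b = (a + 1) mod n"
      using shift_mod_eq_iff[OF ab(2), of "(a + 1) mod n" i] by simp
    also have "\<dots> \<longleftrightarrow> b = a + 1 \<or> b = 0 \<and> a = n - 1"
      using ab by (cases "a + 1 = n") auto
    finally show ?thesis .
  qed
  have "((i + j) mod n, (i + k) mod n) \<in> parcs (cycle_graph n) \<longleftrightarrow>
    (i + k) mod n = ((i + j) mod n + 1) mod n \<or> (i + j) mod n = ((i + k) mod n + 1) mod n"
    using assms by (simp add: cycle_graph_def)
  also have "\<dots> \<longleftrightarrow> (k = j + 1 \<or> k = 0 \<and> j = n - 1) \<or> (j = k + 1 \<or> j = 0 \<and> k = n - 1)"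
    by (simp only: succ[OF assms(2,3)] succ[OF assms(3,2)])
  finally show ?thesis by auto
qed

lemma parcs_cycle_graph_iff:
  assumes "n \<ge> 3"
  shows "(j, k) \<in> parcs (cycle_graph n) \<longleftrightarrow>
    j < n \<and> k < n \<and> (k = j + 1 \<or> j = k + 1 \<or> j = 0 \<and> k = n - 1 \<or> k = 0 \<and> j = n - 1)"
proof (cases "j < n \<and> k < n")
  case True
  then show ?thesis using parcs_cycle_graph_shift[of n j k 0] assms by simp
qed (auto simp: cycle_graph_def)

section \<open>Large general position sets\<close>

lemma copies_general_position_set:
  assumes "pair_graph G"
  shows "general_position_set (mycielskian G) (Copy ` pverts G)"
proof (rule general_position_set_if_diameter_le_2)
  interpret M: pair_graph "mycielskian G" by (rule pair_graph_mycielskian[OF assms])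
  show "pair_wf_digraph (mycielskian G)" by unfold_locales
  show "(x, z) \<in> parcs (mycielskian G) \<or>
      (\<exists>y. (x, y) \<in> parcs (mycielskian G) \<and> (y, z) \<in> parcs (mycielskian G))"
    if "x \<in> Copy ` pverts G" "z \<in> Copy ` pverts G" for x z
    using that by (intro disjI2 exI[of _ Root]) auto
qed (auto simp: pverts_mycielskian)

lemma gp_number_mycielskian_cycle_3_ge: "gp_number (mycielskian (cycle_graph 3)) \<ge> 4"
proof -
  let ?M = "mycielskian (cycle_graph 3)"
  let ?S = "{Root, Orig 0, Orig 1, Orig (2 :: nat)}"
  interpret M: pair_graph ?M
    by (intro pair_graph_mycielskian pair_graph_cycle_graph) simp
  note arc = parcs_cycle_graph_iff[of 3]
  have "general_position_set ?M ?S"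
  proof (rule general_position_set_if_diameter_le_2)
    show "pair_wf_digraph ?M" by unfold_locales
    show "?S \<subseteq> pverts ?M" by (auto simp: pverts_mycielskian)
    fix x z assume "x \<in> ?S" "z \<in> ?S" "x \<noteq> z"
    \<comment> \<open>Two originals are adjacent; the root and an original meet in a copy of another vertex.\<close>
    then have "(x, z) \<in> parcs ?M \<or> (\<exists>y \<in> {Copy 0, Copy 1}.
      (x, y) \<in> parcs ?M \<and> (y, z) \<in> parcs ?M)"
      by (auto simp: arc)
    then show "(x, z) \<in> parcs ?M \<or> (\<exists>y. (x, y) \<in> parcs ?M \<and> (y, z) \<in> parcs ?M)"
      by blast
  qed (auto simp: arc)
  then have "card ?S \<le> gp_number ?M" by (intro gp_number_attained) auto
  then show ?thesis by simp
qed

text \<open>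
  The Mycielskian of the 5-cycle is the Groetzsch graph, which has diameter 2 and no triangles.
  General position sets are here the vertex sets that induce a graph of maximum degree at most 1.
\<close>

lemma gp_number_mycielskian_cycle_5_ge: "gp_number (mycielskian (cycle_graph 5)) \<ge> 6"
proof -
  let ?M = "mycielskian (cycle_graph 5)"
  let ?S = "{Orig 0, Orig 2, Copy 0, Copy 2, Copy 3, Copy (4 :: nat)}"
  interpret M: pair_graph ?M
    by (intro pair_graph_mycielskian pair_graph_cycle_graph) simp
  note arc = parcs_cycle_graph_iff[of 5]
  have "general_position_set ?M ?S"
  proof (rule general_position_set_if_diameter_le_2)
    show "pair_wf_digraph ?M" by unfold_locales
    show "?S \<subseteq> pverts ?M" by (auto simp: pverts_mycielskian)
    fix x z assume "x \<in> ?S" "z \<in> ?S" "x \<noteq> z"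
    \<comment> \<open>Copies have the root as common neighbour. An original and another vertex that are not
      adjacent have a common neighbour among the originals next to 0 or 2.\<close>
    then have "(x, z) \<in> parcs ?M \<or> (\<exists>y \<in> {Orig 1, Orig 3, Orig 4, Root}.
      (x, y) \<in> parcs ?M \<and> (y, z) \<in> parcs ?M)"
      by (auto simp: arc)
    then show "(x, z) \<in> parcs ?M \<or> (\<exists>y. (x, y) \<in> parcs ?M \<and> (y, z) \<in> parcs ?M)"
      by blast
  next
    have edge: "(x, y) \<in> {(Orig 0, Copy 4), (Copy 4, Orig 0), (Orig 2, Copy 3), (Copy 3, Orig 2)}"
      if "x \<in> ?S" "y \<in> ?S" "(x, y) \<in> parcs ?M" for x y
      using that by (auto simp: arc)
    show "(x, z) \<in> parcs ?M"
      if "{x, y, z} \<subseteq> ?S" "(x, y) \<in> parcs ?M" "(y, z) \<in> parcs ?M" "x \<noteq> z" for x y z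
    proof -
      have "x \<in> ?S" "y \<in> ?S" "z \<in> ?S" using that(1) by simp_all
      note edge[OF this(1,2) that(2)] edge[OF this(2,3) that(3)]
      then show ?thesis using \<open>x \<noteq> z\<close> by auto
    qed
  qed
  then have "card ?S \<le> gp_number ?M" by (intro gp_number_attained) auto
  then show ?thesis by simp
qed

section \<open>The upper bound\<close>

locale mycielskian_cycle_general_position =
  mycielskian_general_position "cycle_graph n" S for n S +
  assumes n: "n \<ge> 3"
begin

definition shift :: "nat \<Rightarrow> nat \<Rightarrow> nat" where
  "shift i k = (i + k) mod n"

lemma shift_0: "i < n \<Longrightarrow> shift i 0 = i"
  by (simp add: shift_def)

lemma shift_eq_iff: "j < n \<Longrightarrow> k < n \<Longrightarrow> shift i j = shift i k \<longleftrightarrow> j = k"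
  unfolding shift_def by (rule shift_mod_eq_iff)

lemma obtain_shift:
  assumes "u < n"
  obtains k where "k < n" "u = shift i k"
  using assms shift_mod_image[of n i] by (force simp: shift_def)

lemma arc_shift_iff:
  "j < n \<Longrightarrow> k < n \<Longrightarrow> (shift i j, shift i k) \<in> parcs (cycle_graph n) \<longleftrightarrow>
    k = j + 1 \<or> j = k + 1 \<or> j = 0 \<and> k = n - 1 \<or> k = 0 \<and> j = n - 1"
  unfolding shift_def using n by (rule parcs_cycle_graph_shift)

text \<open>Both sets consist of vertices of the cycle, so that they can be compared with each other.\<close>

definition "origs = {u. Orig u \<in> S}"
definition "copies = {u. Copy u \<in> S}"

lemma origs_subset: "origs \<subseteq> {0..<n}"
  and copies_subset: "copies \<subseteq> {0..<n}"
  using subset_mycielskian by (auto simp: origs_def copies_def pverts_mycielskian)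

lemma card_eq_origs_plus_copies: "card S = card origs + card copies + (if Root \<in> S then 1 else 0)"
proof -
  have S: "S = (Orig ` origs \<union> Copy ` copies) \<union> (if Root \<in> S then {Root} else {})" (is "_ = ?T \<union> ?R")
  proof (rule set_eqI)
    show "x \<in> S \<longleftrightarrow> x \<in> ?T \<union> ?R" for x
      by (cases x) (auto simp: origs_def copies_def)
  qed
  have fin: "finite origs" "finite copies"
    using origs_subset copies_subset finite_subset by blast+
  have "card ?T = card origs + card copies"
    using fin by (subst card_Un_disjoint) (auto simp: card_image inj_on_def)
  moreover have "card (?T \<union> ?R) = card ?T + card ?R"
    using fin by (intro card_Un_disjoint) auto
  moreover have "card S = card (?T \<union> ?R)" using S by (rule arg_cong)
  ultimately show ?thesis by simp
qed

text \<open>Sizes are bounded by listing, relative to a base point \<open>i\<close>, positions known to be empty.\<close>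

lemma card_le_shifted:
  assumes "X \<subseteq> {0..<n}" "K \<subseteq> {0..<n}" "\<And>k. k \<in> K \<Longrightarrow> shift i k \<notin> X"
  shows "card X \<le> n - card K"
proof -
  have "X \<subseteq> shift i ` ({0..<n} - K)"
  proof
    fix x assume "x \<in> X"
    moreover from this have "x < n" using assms(1) by auto
    then obtain k where "k < n" "x = shift i k" by (rule obtain_shift)
    ultimately show "x \<in> shift i ` ({0..<n} - K)" using assms(3) by auto
  qed
  then have "card X \<le> card ({0..<n} - K)" by (intro surj_card_le) auto
  then show ?thesis using assms(2) by (simp add: card_Diff_subset finite_subset)
qed

text \<open>
  In a triangle the outer two of three consecutive vertices would be adjacent, hence \<open>n \<ge> 4\<close>.
\<close>

lemma no_three_consecutive_origs:
  assumes "n \<ge> 4" "k + 2 < n"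
  obtains j where "j \<in> {k, k + 1, k + 2}" "shift i j \<notin> origs"
proof -
  have "k > 0 \<or> k + 2 \<noteq> n - 1" using assms by linarith
  then have "shift i k \<notin> origs \<or> shift i (k + 1) \<notin> origs \<or> shift i (k + 2) \<notin> origs"
    using assms n no_orig_orig_orig[of "shift i k" "shift i (k + 1)" "shift i (k + 2)"]
    unfolding origs_def
    by (auto simp: arc_shift_iff shift_eq_iff)
  then show thesis using that by blast
qed

text \<open>
  At most one copy is present, so it suffices to find two missing originals when \<open>n \<ge> 4\<close>. The
  positions 0, 1, 2 contain one of them, and the three positions after that one contain another.
  For \<open>n = 3\<close> one missing original is enough, and one is missing as soon as a copy of \<open>u\<close>
  is present: \<open>u\<close> and its successor cannot both be there.
\<close>

lemma card_le_if_Root: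
  assumes "Root \<in> S"
  shows "card S \<le> (if n = 3 then 4 else n)"
proof -
  have copies1: "card copies \<le> 1"
    using assms no_Root_two_copies finite_subset[OF copies_subset]
    by (auto simp: copies_def card_le_Suc0_iff_eq)
  show ?thesis
  proof (cases "n = 3")
    case True
    have "card origs \<le> 2" if "copies \<noteq> {}"
    proof -
      obtain u where u: "u \<in> copies" using \<open>copies \<noteq> {}\<close> by blast
      then have u0: "shift u 0 = u" using copies_subset shift_0 by auto
      have "(shift u 0, shift u 1) \<in> parcs (cycle_graph n)"
        "(shift u 0, shift u 0) \<notin> parcs (cycle_graph n)"
        using n by (simp_all add: arc_shift_iff)
      then have "shift u 0 \<notin> origs \<or> shift u 1 \<notin> origs"
        using no_copy_orig_orig[of "shift u 0" "shift u 1" "shift u 0"] u sym_arc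
        unfolding u0 origs_def copies_def by blast
      then obtain k where "k \<in> {0, 1}" "shift u k \<notin> origs" by blast
      then have "card origs \<le> n - card {k}"
        using n by (intro card_le_shifted[of _ _ u] origs_subset) auto
      then show ?thesis using True by simp
    qed
    moreover have "card origs \<le> 3" using card_mono[OF _ origs_subset] True by simp
    ultimately show ?thesis using card_eq_origs_plus_copies assms copies1 True by (cases "copies = {}") auto
  next
    case False
    then have n4: "n \<ge> 4" using n by simp
    obtain j where j: "shift 0 j \<notin> origs"
      by (rule no_three_consecutive_origs[of 0 0]) (use n4 in auto)
    define m where "m = shift 0 j"
    have "shift m 0 \<notin> origs" using j by (simp add: m_def shift_def)
    moreover obtain k where k: "k \<in> {1, 1 + 1, 1 + 2}" "shift m k \<notin> origs"
      by (rule no_three_consecutive_origs[of 1 m]) (use n4 in auto)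
    ultimately have "card origs \<le> n - card {0, k}"
      using n4 by (intro card_le_shifted[of _ _ m] origs_subset) auto
    then have "card origs \<le> n - 2" using k(1) by auto
    then show ?thesis using card_eq_origs_plus_copies assms copies1 False n4 by simp
  qed
qed

text \<open>
  The \<open>n\<close> vertices of the cycle have room for the successors of \<open>origs\<close> next to \<open>copies\<close>.
\<close>

lemma card_le_if_not_shifted_copy:
  assumes "Root \<notin> S" "\<And>i. i \<in> origs \<Longrightarrow> shift i 1 \<notin> copies"
  shows "card S \<le> n"
proof -
  have "inj_on (\<lambda>i. shift i 1) origs"
    using inj_on_subset[OF inj_on_shift_mod origs_subset, of 1] by (simp add: shift_def add.commute)
  then have "card origs + card copies = card ((\<lambda>i. shift i 1) ` origs) + card copies"
    by (simp add: card_image)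
  also have "\<dots> = card ((\<lambda>i. shift i 1) ` origs \<union> copies)"
    using assms(2) finite_subset[OF origs_subset] finite_subset[OF copies_subset]
    by (intro card_Un_disjoint[symmetric]) auto
  also have "\<dots> \<le> card {0..<n}"
    using copies_subset n by (intro card_mono) (auto simp: shift_def)
  finally show ?thesis using card_eq_origs_plus_copies assms(1) by simp
qed

text \<open>
  The edge between the original at position 0 and the copy at position 1 empties most nearby
  positions: for \<open>n \<ge> 4\<close> any further neighbour of one of its ends yields an induced path of
  length 2, and copies at distance 3 from the original are reached by a shortest path that
  starts with this edge.
\<close>

lemma card_le_if_shifted_copy:
  assumes "Root \<notin> S" "i \<in> origs" "shift i 1 \<in> copies"
  shows "card S \<le> (if n = 3 \<or> n = 5 then n + 1 else n)"
proof -
  have O0: "Orig (shift i 0) \<in> S" and C1: "Copy (shift i 1) \<in> S"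
    using assms origs_subset shift_0[of i] by (auto simp: origs_def copies_def)
  have o1: "shift i 1 \<notin> origs"
    using no_copy_orig_orig[of "shift i 1" "shift i 0" "shift i 1"] O0 C1 n
    by (simp add: arc_shift_iff origs_def)
  have c_last: "shift i (n - 1) \<notin> copies"
    using no_copy_orig_copy[of "shift i 1" "shift i 0" "shift i (n - 1)"] O0 C1 n
    by (simp add: arc_shift_iff shift_eq_iff copies_def)
  have o2: "shift i 2 \<notin> origs" if "n \<ge> 4"
    using no_orig_copy_orig[of "shift i 0" "shift i 1" "shift i 2"] O0 C1 that
    by (simp add: arc_shift_iff shift_eq_iff origs_def)
  have o_last: "shift i (n - 1) \<notin> origs" if "n \<ge> 4"
    using no_copy_orig_orig[of "shift i 1" "shift i 0" "shift i (n - 1)"] O0 C1 that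
    by (simp add: arc_shift_iff shift_eq_iff origs_def)
  have c_far: "shift i j \<notin> copies" if j: "3 \<le> j" "j < n - 2" for j
  proof -
    have "(x, shift i j) \<notin> parcs (cycle_graph n)"
      if x: "(shift i 0, x) \<in> parcs (cycle_graph n)" for x
    proof -
      obtain k where "k < n" "x = shift i k"
        using in_arcsD2[OF x] obtain_shift[of x i] by auto
      then show ?thesis using x j by (auto simp: arc_shift_iff)
    qed
    then show ?thesis
      using no_orig_copy_far_copy[of "shift i 0" "shift i 1" "shift i j"] O0 C1 j
      by (simp add: arc_shift_iff shift_eq_iff copies_def)
  qed
  consider "n = 3" | "n = 4 \<or> n = 5" | "n = 6" | "n \<ge> 7" using n by linarith
  then show ?thesis
  proof cases
    case 1
    have "card origs \<le> n - card {1 :: nat}" "card copies \<le> n - card {n - 1}"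
      using o1 c_last n by (intro card_le_shifted[of _ _ i] origs_subset copies_subset; simp)+
    then show ?thesis using card_eq_origs_plus_copies assms(1) 1 by simp
  next
    case 2
    have "card origs \<le> n - card {1, 2, n - 1}" "card copies \<le> n - card {n - 1}"
      using o1 o2 o_last c_last 2
      by (intro card_le_shifted[of _ _ i] origs_subset copies_subset; force)+
    then show ?thesis using card_eq_origs_plus_copies assms(1) 2 by auto
  next
    case 3
    have "card origs \<le> n - card {1, 2, 5 :: nat}" "card copies \<le> n - card {3, 5 :: nat}"
      using o1 o2 o_last c_last c_far[of 3] 3
      by (intro card_le_shifted[of _ _ i] origs_subset copies_subset; force)+
    then have le: "card origs \<le> 3" "card copies \<le> 4" using 3 by simp_all
    \<comment> \<open>These bounds add up to 7. If the original 3 is absent, one original fewer remains;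
      if it is present, it lies between the copies 2 and 4, one of which is absent.\<close>
    show ?thesis
    proof (cases "shift i 3 \<in> origs")
      case False
      have "card origs \<le> n - card {1, 2, 3, 5 :: nat}"
        using o1 o2 o_last False 3
        by (intro card_le_shifted[of _ _ i] origs_subset; force)
      then show ?thesis using card_eq_origs_plus_copies assms(1) le 3 by simp
    next
      case True
      moreover have "n \<ge> 6" using 3 by simp
      ultimately have "shift i 2 \<notin> copies \<or> shift i 4 \<notin> copies"
        using no_copy_orig_copy[of "shift i 2" "shift i 3" "shift i 4"]
        by (auto simp: arc_shift_iff shift_eq_iff copies_def origs_def)
      then obtain k where k: "k \<in> {2, 4}" "shift i k \<notin> copies" by blast
      then have "card copies \<le> n - card {3, 5, k}"
        using c_last c_far[of 3] 3
        by (intro card_le_shifted[of _ _ i] copies_subset; force)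
      then have "card copies \<le> 3" using 3 k(1) by auto
      then show ?thesis using card_eq_origs_plus_copies assms(1) le 3 by simp
    qed
  next
    case 4
    \<comment> \<open>Position 5 is still before \<open>n - 1\<close>, so \<open>k\<close> is a fourth empty position.\<close>
    obtain k where k: "k \<in> {3, 3 + 1, 3 + 2}" "shift i k \<notin> origs"
      by (rule no_three_consecutive_origs[of 3 i]) (use 4 in auto)
    have "card origs \<le> n - card {1, 2, n - 1, k}"
      using o1 o2 o_last k 4
      by (intro card_le_shifted[of _ _ i] origs_subset; force)
    moreover have "card {1, 2, n - 1, k} = 4" using k(1) 4 by auto
    moreover have "card copies \<le> n - card (insert (n - 1) {3..<n - 2})"
      using c_last c_far 4
      by (intro card_le_shifted[of _ _ i] copies_subset) auto
    moreover have "card (insert (n - 1) {3..<n - 2}) = n - 4"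
      using 4 by (subst card_insert_disjoint) auto
    ultimately show ?thesis using card_eq_origs_plus_copies assms(1) 4 by simp
  qed
qed

lemma card_le: "card S \<le> (if n = 3 \<or> n = 5 then n + 1 else n)"
proof (cases "Root \<in> S")
  case True
  then show ?thesis using card_le_if_Root by (auto split: if_splits)
next
  case False
  show ?thesis
  proof (cases "\<exists>i \<in> origs. shift i 1 \<in> copies")
    case True
    then show ?thesis using card_le_if_shifted_copy \<open>Root \<notin> S\<close> by blast
  next
    case no_shifted: False
    then have "card S \<le> n" using card_le_if_not_shifted_copy \<open>Root \<notin> S\<close> by blast
    then show ?thesis by simp
  qed
qed

end

theorem theorem23:
  fixes n :: nat
  assumes "n \<ge> 3"
  shows "gp_number (mycielskian (cycle_graph n)) = (if n = 3 \<or> n = 5 then n + 1 else n)"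
proof (rule antisym)
  let ?M = "mycielskian (cycle_graph n)"
  interpret C: pair_graph "cycle_graph n" by (rule pair_graph_cycle_graph[OF assms])
  have fin: "finite (pverts ?M)" by (simp add: pverts_mycielskian)
  obtain S where S: "general_position_set ?M S" "card S = gp_number ?M"
    using gp_number_attained(1)[OF fin] by blast
  interpret mycielskian_cycle_general_position n S
    by unfold_locales (use S assms in auto)
  show "gp_number ?M \<le> (if n = 3 \<or> n = 5 then n + 1 else n)"
    using card_le S(2) by simp
  have "card (Copy ` pverts (cycle_graph n)) \<le> gp_number ?M"
    by (intro gp_number_attained(2)[OF fin] copies_general_position_set pair_graph_cycle_graph assms)
  then have "n \<le> gp_number ?M" by (simp add: card_image inj_on_def)
  then show "(if n = 3 \<or> n = 5 then n + 1 else n) \<le> gp_number ?M"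
    using gp_number_mycielskian_cycle_3_ge gp_number_mycielskian_cycle_5_ge by auto
qed

end
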